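(* For each $f\in C_{\varphi(T)}$, there are an isomorphism $\theta\colon V^{\vee}\xrightarrow{\sim}V$ and a linear map $\kappa\colon V\to V^{\vee}$ satisfying $f=\theta\circ\kappa$, ${}^t\theta=\theta$ and ${}^t\kappa=\kappa$.
   Context: $V$ is a vector space over $\mathbb C$ of dimension $r$, $\varphi(T)\in\mathbb C[T]$ is a monic polynomial of degree $r$, and $C_{\varphi(T)}$ is the set of linear maps $f\colon V\to V$ whose minimal polynomial is $\varphi(T)$. $V^\vee$ is the dual space; ${}^t\theta\colon V^\vee\to(V^\vee)^\vee=V$ and ${}^t\kappa\colon V=(V^\vee)^\vee\to V^\vee$ are the dual maps of $\theta$ and $\kappa$. *)

theory Defs
  imports Complex_Main "HOL-Computational_Algebra.Polynomial"
begin

class complex_vector = ab_group_add +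
  fixes scaleC :: "complex \<Rightarrow> 'a \<Rightarrow> 'a"  (infixr "*\<^sub>C" 75)
  assumes scaleC_add_right: "a *\<^sub>C (x + y) = a *\<^sub>C x + a *\<^sub>C y"
    and scaleC_add_left: "(a + b) *\<^sub>C x = a *\<^sub>C x + b *\<^sub>C x"
    and scaleC_scaleC: "a *\<^sub>C b *\<^sub>C x = (a * b) *\<^sub>C x"
    and scaleC_one: "1 *\<^sub>C x = x"

lemma vector_space_scaleC: "vector_space (scaleC :: complex \<Rightarrow> 'v \<Rightarrow> 'v::complex_vector)"
  by unfold_locales (simp_all add: scaleC_add_right scaleC_add_left scaleC_scaleC scaleC_one)

lemma vector_space_mult: "vector_space ((*) :: complex \<Rightarrow> complex \<Rightarrow> complex)"
  by unfold_locales (simp_all add: algebra_simps)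

abbreviation clinear :: "('v::complex_vector \<Rightarrow> 'w::complex_vector) \<Rightarrow> bool" where
  "clinear \<equiv> Vector_Spaces.linear scaleC scaleC"

abbreviation cfunctional :: "('v::complex_vector \<Rightarrow> complex) \<Rightarrow> bool" where
  "cfunctional \<equiv> Vector_Spaces.linear scaleC (*)"

lemma clinear_iff:
  "clinear T \<longleftrightarrow> (\<forall>x y. T (x + y) = T x + T y) \<and> (\<forall>c x. T (c *\<^sub>C x) = c *\<^sub>C T x)"
  by (simp add: Vector_Spaces.linear_iff vector_space_scaleC)

lemma cfunctional_iff:
  "cfunctional g \<longleftrightarrow> (\<forall>x y. g (x + y) = g x + g y) \<and> (\<forall>c x. g (c *\<^sub>C x) = c * g x)"
  by (simp add: Vector_Spaces.linear_iff vector_space_scaleC vector_space_mult)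

typedef (overloaded) 'v dual = "{g :: 'v::complex_vector \<Rightarrow> complex. cfunctional g}"
  morphisms dual_apply Dual
  by (rule exI[of _ "\<lambda>_. 0"]) (simp add: cfunctional_iff)

lemma cfunctional_dual_apply: "cfunctional (dual_apply \<xi>)"
  using dual_apply[of \<xi>] by simp

lemma dual_apply_Dual: "cfunctional g \<Longrightarrow> dual_apply (Dual g) = g"
  by (simp add: Dual_inverse)

lemma dual_eqI: "(\<And>v. dual_apply \<xi> v = dual_apply \<eta> v) \<Longrightarrow> \<xi> = \<eta>"
  by (metis dual_apply_inject ext)

lemma dual_apply_add_right: "dual_apply \<xi> (x + y) = dual_apply \<xi> x + dual_apply \<xi> y"
  and dual_apply_scaleC_right: "dual_apply \<xi> (c *\<^sub>C x) = c * dual_apply \<xi> x"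
  using cfunctional_dual_apply[of \<xi>] by (simp_all add: cfunctional_iff)

instantiation dual :: (complex_vector) complex_vector
begin

definition zero_dual :: "'a dual" where
  "zero_dual = Dual (\<lambda>_. 0)"
definition plus_dual :: "'a dual \<Rightarrow> 'a dual \<Rightarrow> 'a dual" where
  "\<xi> + \<eta> = Dual (\<lambda>v. dual_apply \<xi> v + dual_apply \<eta> v)"
definition uminus_dual :: "'a dual \<Rightarrow> 'a dual" where
  "- \<xi> = Dual (\<lambda>v. - dual_apply \<xi> v)"
definition minus_dual :: "'a dual \<Rightarrow> 'a dual \<Rightarrow> 'a dual" where
  "\<xi> - \<eta> = Dual (\<lambda>v. dual_apply \<xi> v - dual_apply \<eta> v)"
definition scaleC_dual :: "complex \<Rightarrow> 'a dual \<Rightarrow> 'a dual" where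
  "c *\<^sub>C \<xi> = Dual (\<lambda>v. c * dual_apply \<xi> v)"

lemma dual_apply_ops:
  "dual_apply (0 :: 'a dual) v = 0"
  "dual_apply (\<xi> + \<eta> :: 'a dual) v = dual_apply \<xi> v + dual_apply \<eta> v"
  "dual_apply (- \<xi> :: 'a dual) v = - dual_apply \<xi> v"
  "dual_apply (\<xi> - \<eta> :: 'a dual) v = dual_apply \<xi> v - dual_apply \<eta> v"
  "dual_apply (c *\<^sub>C \<xi> :: 'a dual) v = c * dual_apply \<xi> v"
  by (simp_all add: zero_dual_def plus_dual_def uminus_dual_def minus_dual_def scaleC_dual_def
      dual_apply_Dual cfunctional_iff dual_apply_add_right dual_apply_scaleC_right algebra_simps)

instance
  by standard (rule dual_eqI; simp add: dual_apply_ops algebra_simps)+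

end

text \<open>Dual maps. If \<open>T\<close> is not linear, the value of \<open>dual_map T\<close> is unspecified.\<close>

definition dual_map ::
    "('v::complex_vector \<Rightarrow> 'w::complex_vector) \<Rightarrow> 'w dual \<Rightarrow> 'v dual" where
  "dual_map T \<eta> = Dual (\<lambda>v. dual_apply \<eta> (T v))"

lemma dual_apply_dual_map:
  assumes "clinear T"
  shows "dual_apply (dual_map T \<eta>) v = dual_apply \<eta> (T v)"
  using assms by (simp add: dual_map_def dual_apply_Dual cfunctional_iff clinear_iff
      dual_apply_add_right dual_apply_scaleC_right)

text \<open>The canonical map from \<open>V\<close> to its bidual. In finite dimension it is an isomorphism, and it
  is the identification meant when one writes \<open>V\<close> for the bidual.\<close>

definition bidual :: "'v::complex_vector \<Rightarrow> 'v dual dual" where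
  "bidual v = Dual (\<lambda>\<xi>. dual_apply \<xi> v)"

lemma dual_apply_bidual: "dual_apply (bidual v) \<xi> = dual_apply \<xi> v"
  by (simp add: bidual_def dual_apply_Dual cfunctional_iff dual_apply_ops)

lemma clinear_bidual: "clinear bidual"
  by (auto simp: clinear_iff dual_apply_bidual dual_apply_ops dual_apply_add_right
      dual_apply_scaleC_right intro!: dual_eqI)

lemma bij_bidual:
  fixes Basis :: "'v::complex_vector set"
  assumes "finite_dimensional_vector_space (scaleC :: complex \<Rightarrow> 'v \<Rightarrow> 'v) Basis"
  shows "bij (bidual :: 'v \<Rightarrow> 'v dual dual)"
proof -
  interpret finite_dimensional_vector_space "scaleC :: complex \<Rightarrow> 'v \<Rightarrow> 'v" Basis
    by (rule assms)
  define e where "e b = Dual (\<lambda>v. representation Basis v b)" for b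
  have e: "dual_apply (e b) v = representation Basis v b" for b v
    unfolding e_def
    by (subst dual_apply_Dual)
      (simp_all add: cfunctional_iff representation_add representation_scale
        independent_Basis span_Basis)
  have expand: "(\<Sum>b\<in>Basis. dual_apply (e b) v *\<^sub>C b) = v" for v
    unfolding e using sum_representation_eq[of Basis v Basis]
    by (simp add: independent_Basis span_Basis finite_Basis)
  have "inj (bidual :: 'v \<Rightarrow> 'v dual dual)"
  proof (rule injI)
    fix v w :: 'v
    assume "bidual v = bidual w"
    then have eq: "dual_apply \<xi> v = dual_apply \<xi> w" for \<xi>
      using dual_apply_bidual[of v \<xi>] dual_apply_bidual[of w \<xi>] by simp
    have "v = (\<Sum>b\<in>Basis. dual_apply (e b) v *\<^sub>C b)"
      by (rule expand[symmetric])
    also have "\<dots> = (\<Sum>b\<in>Basis. dual_apply (e b) w *\<^sub>C b)"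
      by (simp only: eq)
    also have "\<dots> = w"
      by (rule expand)
    finally show "v = w" .
  qed
  moreover have "\<Lambda> = bidual (\<Sum>b\<in>Basis. dual_apply \<Lambda> (e b) *\<^sub>C b)" for \<Lambda> :: "'v dual dual"
  proof (rule dual_eqI)
    fix \<xi> :: "'v dual"
    have sum_right: "dual_apply \<zeta> (sum h A) = (\<Sum>x\<in>A. dual_apply \<zeta> (h x))" if "finite A"
      for \<zeta> :: "'w::complex_vector dual" and h and A :: "'v set"
      using that dual_apply_add_right[of \<zeta> 0 0]
      by (induction A) (simp_all add: dual_apply_add_right)
    have sum_left: "dual_apply (sum h A) v = (\<Sum>x\<in>A. dual_apply (h x) v)" if "finite A"
      for h :: "'v \<Rightarrow> 'v dual" and A v
      using that by (induction A) (simp_all add: dual_apply_ops)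
    have "\<xi> = (\<Sum>b\<in>Basis. dual_apply \<xi> b *\<^sub>C e b)"
    proof (rule dual_eqI)
      fix v
      have "dual_apply \<xi> v = dual_apply \<xi> (\<Sum>b\<in>Basis. dual_apply (e b) v *\<^sub>C b)"
        by (simp only: expand)
      then show "dual_apply \<xi> v = dual_apply (\<Sum>b\<in>Basis. dual_apply \<xi> b *\<^sub>C e b) v"
        by (simp add: sum_right sum_left finite_Basis dual_apply_scaleC_right dual_apply_ops
            mult.commute)
    qed
    then have "dual_apply \<Lambda> \<xi> = dual_apply \<Lambda> (\<Sum>b\<in>Basis. dual_apply \<xi> b *\<^sub>C e b)"
      by (rule arg_cong)
    then show "dual_apply \<Lambda> \<xi> = dual_apply (bidual (\<Sum>b\<in>Basis. dual_apply \<Lambda> (e b) *\<^sub>C b)) \<xi>"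
      by (simp add: sum_right finite_Basis dual_apply_scaleC_right dual_apply_bidual mult.commute)
  qed
  then have "surj (bidual :: 'v \<Rightarrow> 'v dual dual)"
    unfolding surj_def by blast
  ultimately show ?thesis by (simp add: bij_def)
qed

definition poly_endo :: "complex poly \<Rightarrow> ('v::complex_vector \<Rightarrow> 'v) \<Rightarrow> 'v \<Rightarrow> 'v" where
  "poly_endo p f v = (\<Sum>i\<le>degree p. coeff p i *\<^sub>C (f ^^ i) v)"

text \<open>The minimal polynomial is the monic generator of the ideal of polynomials annihilating
  \<open>f\<close>; on the zero space it is \<open>1\<close>.\<close>

definition is_minimal_poly :: "('v::complex_vector \<Rightarrow> 'v) \<Rightarrow> complex poly \<Rightarrow> bool" where
  "is_minimal_poly f p \<longleftrightarrow>
     lead_coeff p = 1 \<and> poly_endo p f = (\<lambda>v. 0) \<and>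
     (\<forall>q. poly_endo q f = (\<lambda>v. 0) \<longrightarrow> p dvd q)"

definition maps_with_minimal_poly :: "complex poly \<Rightarrow> ('v::complex_vector \<Rightarrow> 'v) set" where
  "maps_with_minimal_poly p = {f. clinear f \<and> is_minimal_poly f p}"

end

theory Submission
  imports Defs
    "HOL-Computational_Algebra.Field_as_Ring"
    "HOL-Computational_Algebra.Polynomial_Factorial"
    "HOL-Computational_Algebra.Fundamental_Theorem_Algebra"
begin

text \<open>Since the minimal polynomial \<open>\<phi>\<close> of \<open>f\<close> has degree \<open>dim V\<close>, there is a cyclic vector, so
  \<open>V\<close> is isomorphic to \<open>\<complex>[T]/(\<phi>)\<close> with \<open>f\<close> acting as multiplication by \<open>T\<close>. The form
  sending \<open>(p, q)\<close> to the coefficient of \<open>T^(r-1)\<close> in \<open>p q mod \<phi>\<close> is symmetric and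
  nondegenerate, and \<open>f\<close> is self-adjoint for it. With \<open>\<beta> : V \<rightarrow> V\<^sup>\<or>\<close> the induced isomorphism, put
  \<open>\<theta> = \<beta>\<^sup>-\<^sup>1\<close> and \<open>\<kappa> = \<beta> \<circ> f\<close>.\<close>

interpretation cvs: vector_space "scaleC :: complex \<Rightarrow> 'v \<Rightarrow> 'v::complex_vector"
  by (rule vector_space_scaleC)

lemma clinearD:
  assumes "clinear T"
  shows clinear_add: "T (x + y) = T x + T y"
    and clinear_scaleC: "T (c *\<^sub>C x) = c *\<^sub>C T x"
    and clinear_zero: "T 0 = 0"
proof -
  show *: "T (x + y) = T x + T y" "T (c *\<^sub>C x) = c *\<^sub>C T x" for x y c
    using assms by (auto simp: clinear_iff)
  show "T 0 = 0" using *(1)[of 0 0] by simp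
qed

section \<open>Polynomials in an endomorphism\<close>

lemma poly_endo_0 [simp]: "poly_endo 0 f v = 0"
  by (simp add: poly_endo_def)

text \<open>Placing the extra \<open>f\<close> on the argument makes the recursion valid without
  linearity. The vector changes along it, so inductions on the polynomial generalize over
  \<open>v\<close>.\<close>

lemma poly_endo_pCons: "poly_endo (pCons a p) f v = a *\<^sub>C v + poly_endo p f (f v)"
  by (cases "p = 0")
    (simp_all add: poly_endo_def sum.atMost_Suc_shift funpow_Suc_right del: funpow.simps sum.atMost_Suc)

lemma poly_endo_add: "poly_endo (p + q) f v = poly_endo p f v + poly_endo q f v"
  by (induction p q arbitrary: v rule: poly_induct2) (simp_all add: poly_endo_pCons scaleC_add_left)

lemma poly_endo_smult: "poly_endo (smult c p) f v = c *\<^sub>C poly_endo p f v"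
  by (induction p arbitrary: v) (simp_all add: poly_endo_pCons scaleC_add_right scaleC_scaleC)

lemma poly_endo_minus: "poly_endo (- p) f v = - poly_endo p f v"
  using poly_endo_smult[of "-1" p f v] by simp

lemma poly_endo_diff: "poly_endo (p - q) f v = poly_endo p f v - poly_endo q f v"
  using poly_endo_add[of p "- q" f v] by (simp add: poly_endo_minus)

lemma clinear_poly_endo:
  assumes "clinear f"
  shows "clinear (poly_endo p f)"
proof -
  have "poly_endo p f (x + y) = poly_endo p f x + poly_endo p f y" for x y
    by (induction p arbitrary: x y)
      (simp_all add: poly_endo_pCons scaleC_add_right clinear_add[OF assms] add_ac)
  moreover have "poly_endo p f (c *\<^sub>C x) = c *\<^sub>C poly_endo p f x" for c x
    by (induction p arbitrary: x)
      (simp_all add: poly_endo_pCons scaleC_add_right scaleC_scaleC clinear_scaleC[OF assms] mult.commute)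
  ultimately show ?thesis by (simp add: clinear_iff)
qed

lemma poly_endo_commute:
  assumes "clinear f"
  shows "poly_endo p f (f v) = f (poly_endo p f v)"
  by (induction p arbitrary: v)
    (simp_all add: poly_endo_pCons clinearD[OF assms])

lemma poly_endo_mult:
  assumes "clinear f"
  shows "poly_endo (p * q) f v = poly_endo p f (poly_endo q f v)"
  by (induction p arbitrary: v)
    (simp_all add: poly_endo_pCons poly_endo_add poly_endo_smult poly_endo_commute[OF assms])

lemma poly_endo_monom: "poly_endo (monom c n) f v = c *\<^sub>C (f ^^ n) v"
  by (induction n arbitrary: v)
    (simp_all add: monom_0 monom_Suc poly_endo_pCons funpow_Suc_right del: funpow.simps(2))

section \<open>Existence of a cyclic vector\<close>

text \<open>Finitely many proper subspaces, here the kernels, cannot cover a space over an infinite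
  field. Inductively, on a line \<open>v + c *\<^sub>C w\<close> each map of \<open>S\<close>
  vanishes for at most one \<open>c\<close>, so some \<open>c\<close> avoids all of them.\<close>

lemma common_nonvanishing_vector:
  fixes T :: "'i \<Rightarrow> 'v::complex_vector \<Rightarrow> 'w::complex_vector"
  assumes "finite S" "\<And>i. i \<in> S \<Longrightarrow> clinear (T i)" "\<And>i. i \<in> S \<Longrightarrow> \<exists>v. T i v \<noteq> 0"
  shows "\<exists>v. \<forall>i\<in>S. T i v \<noteq> 0"
  using assms
proof (induction S)
  case empty
  then show ?case by simp
next
  case (insert a S)
  then obtain v where v: "\<forall>i\<in>S. T i v \<noteq> 0" by blast
  obtain w where w: "T a w \<noteq> 0" using insert.prems by blast
  have expand: "T i (v + c *\<^sub>C w) = T i v + c *\<^sub>C T i w" if "i \<in> insert a S" for i c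
    using that insert.prems(1)[of i] by (simp add: clinear_add clinear_scaleC)
  show ?case
  proof (cases "T a v = 0")
    case False
    with v show ?thesis by blast
  next
    case True
    define bad where "bad i = {c. T i v + c *\<^sub>C T i w = 0}" for i
    have "finite (bad i)" if "i \<in> S" for i
    proof (rule finite_subset)
      \<comment> \<open>If \<open>bad i\<close> is empty, \<open>c0\<close> is an arbitrary number
        and the inclusion is vacuous.\<close>
      define c0 where "c0 = (SOME c. c \<in> bad i)"
      show "bad i \<subseteq> {c0}"
      proof
        fix c assume c: "c \<in> bad i"
        then have "c0 \<in> bad i" unfolding c0_def by (rule someI)
        with c have "c *\<^sub>C T i w = c0 *\<^sub>C T i w"
          unfolding bad_def by (simp add: add_eq_0_iff)
        moreover have "T i w \<noteq> 0"
          using c v that by (auto simp: bad_def)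
        ultimately show "c \<in> {c0}" by simp
      qed
    qed simp
    \<comment> \<open>Excluding 0 as well handles the new map: here \<open>T a v = 0\<close>, so its
      value on the line is \<open>c *\<^sub>C T a w\<close>.\<close>
    then have "finite (insert 0 (\<Union>i\<in>S. bad i))" using insert.hyps by simp
    then obtain c where c: "c \<notin> insert 0 (\<Union>i\<in>S. bad i)"
      using ex_new_if_finite[OF infinite_UNIV_char_0] by blast
    have "T i (v + c *\<^sub>C w) \<noteq> 0" if "i \<in> insert a S" for i
      using that c w True expand[OF that, of c] by (auto simp: bad_def)
    then show ?thesis by blast
  qed
qed

text \<open>By minimality no quotient \<phi>/(T - a), for a root a of \<phi>, annihilates
  \<open>f\<close>, so some \<open>v\<close> is killed by none of these quotients. If p kills
  \<open>v\<close>, so does the gcd of p and \<phi>; were that a proper divisor of \<phi>, it would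
  divide one of the quotients, which would then kill \<open>v\<close>.\<close>

lemma separating_vector_exists:
  fixes f :: "'v::complex_vector \<Rightarrow> 'v"
  assumes f: "clinear f" and min: "is_minimal_poly f \<phi>"
  obtains v where "\<And>p. poly_endo p f v = 0 \<longleftrightarrow> \<phi> dvd p"
proof -
  have \<phi>0: "\<phi> \<noteq> 0" using min by (auto simp: is_minimal_poly_def)
  define S where "S = {a. poly \<phi> a = 0}"
  define q where "q a = \<phi> div [:-a, 1:]" for a
  have q: "\<phi> = [:-a, 1:] * q a" if "a \<in> S" for a
    using that unfolding S_def q_def by (metis dvd_mult_div_cancel mem_Collect_eq poly_eq_0_iff_dvd)
  have "\<exists>v. \<forall>a\<in>S. poly_endo (q a) f v \<noteq> 0"
  proof (rule common_nonvanishing_vector)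
    show "finite S" unfolding S_def using \<phi>0 by (rule poly_roots_finite)
    show "clinear (poly_endo (q a) f)" for a using f by (rule clinear_poly_endo)
    fix a assume a: "a \<in> S"
    show "\<exists>v. poly_endo (q a) f v \<noteq> 0"
    proof (rule ccontr)
      assume "\<not> ?thesis"
      then have "\<phi> dvd q a" using min by (auto simp: is_minimal_poly_def)
      moreover have "q a \<noteq> 0" using q[OF a] \<phi>0 by auto
      moreover have "degree \<phi> = Suc (degree (q a))"
        using \<open>q a \<noteq> 0\<close> by (subst q[OF a], subst degree_mult_eq) auto
      ultimately show False using dvd_imp_degree_le[of \<phi> "q a"] by simp
    qed
  qed
  then obtain v where v: "\<And>a. a \<in> S \<Longrightarrow> poly_endo (q a) f v \<noteq> 0" by blast
  have "poly_endo p f v = 0 \<longleftrightarrow> \<phi> dvd p" for p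
  proof
    assume "\<phi> dvd p"
    then obtain k where "p = k * \<phi>" by (auto simp: dvd_def mult.commute)
    then show "poly_endo p f v = 0"
      using min by (simp add: poly_endo_mult[OF f] is_minimal_poly_def
          clinear_zero[OF clinear_poly_endo[OF f]])
  next
    assume p: "poly_endo p f v = 0"
    define g where "g = gcd p \<phi>"
    obtain a b where "a * p + b * \<phi> = g"
      unfolding g_def by (metis bezout_coefficients_fst_snd)
    then have "poly_endo g f v = poly_endo (a * p + b * \<phi>) f v" by simp
    also have "\<dots> = 0"
      using p min by (simp add: poly_endo_mult[OF f] is_minimal_poly_def poly_endo_add
          clinear_zero[OF clinear_poly_endo[OF f]])
    finally have g: "poly_endo g f v = 0" .
    have "g dvd \<phi>" by (simp add: g_def)
    then obtain h where h: "\<phi> = g * h" by blast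
    have "h dvd 1"
    proof (rule ccontr)
      assume "\<not> h dvd 1"
      then have "degree h \<noteq> 0" using h \<phi>0 by (auto simp: is_unit_iff_degree)
      then obtain z where z: "poly h z = 0"
        using fundamental_theorem_of_algebra[of h] by (auto simp: constant_degree)
      then obtain k where k: "h = [:-z, 1:] * k" by (auto simp: poly_eq_0_iff_dvd)
      have "z \<in> S" using z h by (simp add: S_def)
      \<comment> \<open>Two factorizations of \<phi> are compared; cancelling the linear factor
        shows that \<open>g\<close> divides \<open>q z\<close>.\<close>
      have "[:-z, 1:] * q z = [:-z, 1:] * (k * g)"
        using q[OF \<open>z \<in> S\<close>] h k by (metis mult.assoc mult.commute)
      then have "q z = k * g" by (subst (asm) mult_cancel_left) auto
      with v[OF \<open>z \<in> S\<close>] g show False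
        by (simp add: poly_endo_mult[OF f] clinear_zero[OF clinear_poly_endo[OF f]])
    qed
    then have "\<phi> dvd g" using h by (metis mult_dvd_mono dvd_refl mult.right_neutral)
    then show "\<phi> dvd p" unfolding g_def by (metis dvd_trans gcd_dvd1)
  qed
  then show thesis by (rule that)
qed

text \<open>A linear relation among the first \<open>degree \<phi>\<close> iterates of a separating
  vector is a polynomial of degree below that of \<phi> killing it, hence zero. These iterates are
  as many as the dimension, so they span.\<close>

lemma cyclic_vector_exists:
  fixes f :: "'v::complex_vector \<Rightarrow> 'v"
  assumes fin: "finite_dimensional_vector_space (scaleC :: complex \<Rightarrow> 'v \<Rightarrow> 'v) Basis"
    and dim: "cvs.dim (UNIV :: 'v set) = degree \<phi>"
    and f: "clinear f" and min: "is_minimal_poly f \<phi>"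
  obtains v where "\<And>p. poly_endo p f v = 0 \<longleftrightarrow> \<phi> dvd p" "\<And>u. \<exists>p. u = poly_endo p f v"
proof -
  interpret finite_dimensional_vector_space "scaleC :: complex \<Rightarrow> 'v \<Rightarrow> 'v" Basis by (rule fin)
  obtain v where v: "\<And>p. poly_endo p f v = 0 \<longleftrightarrow> \<phi> dvd p"
    using separating_vector_exists[OF f min] by blast
  define g where "g i = (f ^^ i) v" for i
  have indep: "\<forall>i<degree \<phi>. c i = 0" if "(\<Sum>i<degree \<phi>. c i *\<^sub>C g i) = 0" for c
  proof -
    define p where "p = (\<Sum>i<degree \<phi>. monom (c i) i)"
    have "poly_endo (\<Sum>i<n. monom (c i) i) f v = (\<Sum>i<n. c i *\<^sub>C g i)" for n
      by (induction n) (simp_all add: poly_endo_add poly_endo_monom g_def)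
    with that have "poly_endo p f v = 0" by (simp add: p_def)
    then have "\<phi> dvd p" by (simp only: v)
    moreover have "coeff p i = (if i < degree \<phi> then c i else 0)" for i
      by (simp add: p_def coeff_sum)
    moreover from this have "p = 0 \<or> degree p < degree \<phi>"
      by (metis leading_coeff_0_iff)
    ultimately show ?thesis
      using dvd_imp_degree_le[of \<phi> p] by (metis coeff_0 not_le)
  qed
  \<comment> \<open>\<open>indep\<close> concerns indexed families, while independence and
    cardinality below concern the image set. A repeated vector would give a relation with
    coefficients 1 and -1.\<close>
  have inj: "inj_on g {..<degree \<phi>}"
  proof (rule inj_onI, rule ccontr)
    fix i j assume ij: "i \<in> {..<degree \<phi>}" "j \<in> {..<degree \<phi>}" "g i = g j" "i \<noteq> j"
    define c where "c k = (if k = i then 1 else 0) - (if k = j then 1 else (0::complex))" for k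
    have "(\<Sum>k<degree \<phi>. c k *\<^sub>C g k) = g i - g j"
      using ij(1,2) by (simp add: c_def cvs.scale_left_diff_distrib sum_subtractf if_distrib[of "\<lambda>x. x *\<^sub>C _"] scaleC_one
          cong: if_cong)
    with ij have "c i = 0" using indep[of c] by simp
    with ij show False by (simp add: c_def)
  qed
  have "cvs.independent (g ` {..<degree \<phi>})"
  proof (rule cvs.independent_if_scalars_zero)
    fix h x assume h: "(\<Sum>x\<in>g ` {..<degree \<phi>}. h x *\<^sub>C x) = 0" and x: "x \<in> g ` {..<degree \<phi>}"
    have "(\<Sum>i<degree \<phi>. h (g i) *\<^sub>C g i) = 0"
      using h by (simp add: sum.reindex[OF inj])
    from indep[OF this] x show "h x = 0" by auto
  qed simp
  moreover have "card (g ` {..<degree \<phi>}) = degree \<phi>" by (simp add: card_image[OF inj])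
  ultimately have span: "UNIV \<subseteq> cvs.span (g ` {..<degree \<phi>})"
    using card_ge_dim_independent[of "g ` {..<degree \<phi>}" UNIV] dim by simp
  have "cvs.subspace (range (\<lambda>p. poly_endo p f v))"
  proof (rule cvs.subspaceI)
    show "0 \<in> range (\<lambda>p. poly_endo p f v)" using poly_endo_0[of f v] by (metis rangeI)
  qed (auto simp: poly_endo_add[symmetric] poly_endo_smult[symmetric])
  moreover have "g ` {..<degree \<phi>} \<subseteq> range (\<lambda>p. poly_endo p f v)"
    using poly_endo_monom[of 1 _ f v] by (auto simp: g_def scaleC_one intro!: image_eqI[OF sym])
  ultimately have "UNIV \<subseteq> range (\<lambda>p. poly_endo p f v)"
    using span cvs.span_minimal by blast
  then have "u \<in> range (\<lambda>p. poly_endo p f v)" for u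
    by (rule subsetD) (rule UNIV_I)
  then have "\<exists>p. u = poly_endo p f v" for u
    unfolding image_iff by simp
  with v show thesis by (rule that)
qed

section \<open>The dual isomorphism and the residue form\<close>

text \<open>Only surjectivity needs work. An injective endomorphism in finite dimension is onto, so
  \<beta> is followed by an injection of the dual back into the space.\<close>

lemma inj_to_dual_imp_bij:
  fixes \<beta> :: "'v::complex_vector \<Rightarrow> 'v dual"
  assumes fin: "finite_dimensional_vector_space (scaleC :: complex \<Rightarrow> 'v \<Rightarrow> 'v) Basis"
    and \<beta>: "clinear \<beta>" and ker: "\<And>u. \<beta> u = 0 \<Longrightarrow> u = 0"
  shows "bij \<beta>"
proof -
  interpret finite_dimensional_vector_space "scaleC :: complex \<Rightarrow> 'v \<Rightarrow> 'v" Basis by (rule fin)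
  have eq_on_Basis: "\<xi> = \<eta>" if "\<And>b. b \<in> Basis \<Longrightarrow> dual_apply \<xi> b = dual_apply \<eta> b" for \<xi> \<eta> :: "'v dual"
  proof (rule dual_eqI)
    fix v
    interpret vector_space_pair "scaleC :: complex \<Rightarrow> 'v \<Rightarrow> 'v" "(*) :: complex \<Rightarrow> _"
      by (simp add: vector_space_pair_def vector_space_scaleC vector_space_mult)
    show "dual_apply \<xi> v = dual_apply \<eta> v"
      by (rule linear_eq_on[OF cfunctional_dual_apply cfunctional_dual_apply, of v Basis])
        (simp_all add: span_Basis that)
  qed
  text \<open>Reading functionals in coordinates turns \<open>\<beta>\<close> into an endomorphism of \<open>V\<close>.\<close>
  define C where "C \<xi> = (\<Sum>b\<in>Basis. dual_apply \<xi> b *\<^sub>C b)" for \<xi> :: "'v dual"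
  have C_inj: "\<xi> = \<eta>" if "C \<xi> = C \<eta>" for \<xi> \<eta>
  proof (rule eq_on_Basis)
    fix b assume b: "b \<in> Basis"
    have "(\<Sum>b\<in>Basis. (dual_apply \<xi> b - dual_apply \<eta> b) *\<^sub>C b) = 0"
      using that by (simp add: C_def cvs.scale_left_diff_distrib sum_subtractf)
    from cvs.independentD[OF independent_Basis finite_Basis subset_refl this b]
    show "dual_apply \<xi> b = dual_apply \<eta> b" by simp
  qed
  have inj_\<beta>: "inj \<beta>"
  proof (rule injI)
    fix x y assume "\<beta> x = \<beta> y"
    moreover have "\<beta> x = \<beta> (x - y) + \<beta> y"
      using clinear_add[OF \<beta>, of "x - y" y] by simp
    ultimately show "x = y" using ker[of "x - y"] by simp
  qed
  have "clinear (C \<circ> \<beta>)"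
    by (simp add: clinear_iff C_def clinear_add[OF \<beta>] clinear_scaleC[OF \<beta>] dual_apply_ops
        scaleC_add_left sum.distrib cvs.scale_sum_right scaleC_scaleC)
  moreover have "inj (C \<circ> \<beta>)"
    using inj_\<beta> C_inj by (metis comp_apply injD injI)
  ultimately have "surj (C \<circ> \<beta>)" by (rule linear_inj_imp_surj)
  \<comment> \<open>Given \<xi>, choose \<open>x\<close> with
    \<open>C (\<beta> x) = C \<xi>\<close>; injectivity of \<open>C\<close> yields
    \<open>\<beta> x = \<xi>\<close>.\<close>
  then have "surj \<beta>" using C_inj unfolding surj_def by (metis comp_apply)
  with inj_\<beta> show ?thesis by (simp add: bij_def)
qed

text \<open>In the proof, the truncated \<open>degree \<phi> - 1\<close> is harmless when \<open>degree \<phi> = 0\<close>: then \<open>\<phi> = 1\<close>,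
  and all residues vanish.\<close>

lemma self_adjoint_form_exists:
  fixes f :: "'v::complex_vector \<Rightarrow> 'v"
  assumes fin: "finite_dimensional_vector_space (scaleC :: complex \<Rightarrow> 'v \<Rightarrow> 'v) Basis"
    and dim: "cvs.dim (UNIV :: 'v set) = degree \<phi>"
    and f: "clinear f" and min: "is_minimal_poly f \<phi>"
  obtains B :: "'v \<Rightarrow> 'v \<Rightarrow> complex"
  where "\<And>u w. B u w = B w u" "\<And>u. cfunctional (B u)"
    "\<And>u w. B (f u) w = B u (f w)" "\<And>u. (\<And>w. B u w = 0) \<Longrightarrow> u = 0"
proof -
  obtain v where ann: "\<And>p. poly_endo p f v = 0 \<longleftrightarrow> \<phi> dvd p"
    and surj: "\<And>u. \<exists>p. u = poly_endo p f v"
    using cyclic_vector_exists[OF fin dim f min] by blast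
  \<comment> \<open>\<open>R u\<close> is the reduced representative of \<open>u\<close> in the
    quotient by \<phi>; reduction makes it independent of the polynomial chosen.\<close>
  define R where "R u = (SOME p. u = poly_endo p f v) mod \<phi>" for u
  have cong: "poly_endo p f v = poly_endo q f v \<longleftrightarrow> p mod \<phi> = q mod \<phi>" for p q
    using ann[of "p - q"] by (simp add: poly_endo_diff mod_eq_dvd_iff)
  have poly_endo_R: "poly_endo (R u) f v = u" for u
    using someI_ex[OF surj[of u]] cong[of "R u" "SOME p. u = poly_endo p f v"]
    by (simp add: R_def)
  have R_eq: "R (poly_endo p f v) = p mod \<phi>" for p
    using cong[of "R (poly_endo p f v)" p] poly_endo_R by (simp add: R_def)
  have R_add: "R (u + w) = R u + R w" for u w
    using R_eq[of "R u + R w"] by (simp add: poly_endo_add poly_endo_R) (simp add: R_def poly_mod_add_left)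
  have R_scale: "R (c *\<^sub>C u) = smult c (R u)" for c u
    using R_eq[of "smult c (R u)"] by (simp add: poly_endo_smult poly_endo_R) (simp add: R_def mod_smult_left)
  have R_f: "R (f u) = ([:0, 1:] * R u) mod \<phi>" for u
    using R_eq[of "[:0, 1:] * R u"]
    by (simp add: poly_endo_pCons poly_endo_commute[OF f] poly_endo_R)
  define B where "B u w = coeff ((R u * R w) mod \<phi>) (degree \<phi> - 1)" for u w
  show thesis
  proof (rule that)
    show "B u w = B w u" for u w by (simp add: B_def mult.commute)
    show "cfunctional (B u)" for u
      by (simp add: cfunctional_iff B_def R_add R_scale distrib_left poly_mod_add_left mod_smult_left)
    \<comment> \<open>Both sides read the same coefficient of T * \<open>R u\<close> *
      \<open>R w\<close> modulo \<phi>.\<close>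
    show "B (f u) w = B u (f w)" for u w
      unfolding B_def R_f by (simp only: mod_mult_left_eq mod_mult_right_eq mult_ac)
    show "u = 0" if u: "\<And>w. B u w = 0" for u
    proof (rule ccontr)
      assume "u \<noteq> 0"
      then have "R u \<noteq> 0" using poly_endo_R[of u] by auto
      moreover have "\<phi> \<noteq> 0" using min by (auto simp: is_minimal_poly_def)
      ultimately have deg: "degree (R u) < degree \<phi>"
        using degree_mod_less[of \<phi> "R u"] by (auto simp: R_def)
      \<comment> \<open>This exponent brings \<open>R u\<close> to degree exactly
        \<open>degree \<phi> - 1\<close>: no reduction occurs, and the coefficient read by
        \<open>B\<close> is the nonzero leading one. By \<open>deg\<close>, \<phi> has positive
        degree, so the subtraction is genuine.\<close>
      define d where "d = degree \<phi> - 1 - degree (R u)"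
      have d: "d + degree (R u) = degree \<phi> - 1" "degree \<phi> - 1 < degree \<phi>"
        using deg by (auto simp: d_def)
      have "R (poly_endo (monom 1 d) f v) = monom 1 d"
        unfolding R_eq using d by (intro mod_poly_less) (simp add: degree_monom_eq)
      moreover have "degree (monom 1 d * R u) < degree \<phi>"
        using d \<open>R u \<noteq> 0\<close> by (subst degree_mult_eq) (simp_all add: degree_monom_eq)
      ultimately have "B u (poly_endo (monom 1 d) f v) = coeff (monom 1 d * R u) (degree \<phi> - 1)"
        by (simp add: B_def mod_poly_less mult.commute)
      also have "\<dots> = lead_coeff (R u)"
        by (simp only: d(1)[symmetric] coeff_monom_mult) simp
      finally show False using u \<open>R u \<noteq> 0\<close> by simp
    qed
  qed
qed

theorem proposition1p1:
  fixes r :: nat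
    and \<phi> :: "complex poly"
    and Basis :: "'v::complex_vector set"
    and f :: "'v \<Rightarrow> 'v"
  assumes "finite_dimensional_vector_space (scaleC :: complex \<Rightarrow> 'v \<Rightarrow> 'v) Basis"
    and "vector_space.dim (scaleC :: complex \<Rightarrow> 'v \<Rightarrow> 'v) UNIV = r"
    and "lead_coeff \<phi> = 1"
    and "degree \<phi> = r"
    and "f \<in> maps_with_minimal_poly \<phi>"
  shows "\<exists>(\<theta> :: 'v dual \<Rightarrow> 'v) (\<kappa> :: 'v \<Rightarrow> 'v dual).
           clinear \<theta> \<and> bij \<theta> \<and> clinear \<kappa> \<and>
           f = \<theta> \<circ> \<kappa> \<and>
           dual_map \<theta> = bidual \<circ> \<theta> \<and>
           dual_map \<kappa> \<circ> bidual = \<kappa>"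
proof -
  have f: "clinear f" and min: "is_minimal_poly f \<phi>"
    using assms(5) by (auto simp: maps_with_minimal_poly_def)
  have dim: "cvs.dim (UNIV :: 'v set) = degree \<phi>" using assms(2,4) by simp
  obtain B :: "'v \<Rightarrow> 'v \<Rightarrow> complex" where sym: "\<And>u w. B u w = B w u"
    and lin: "\<And>u. cfunctional (B u)" and adj: "\<And>u w. B (f u) w = B u (f w)"
    and nondeg: "\<And>u. (\<And>w. B u w = 0) \<Longrightarrow> u = 0"
    using self_adjoint_form_exists[OF assms(1) dim f min] by metis
  define \<beta> where "\<beta> u = Dual (B u)" for u
  have \<beta>_apply: "dual_apply (\<beta> u) w = B u w" for u w
    by (simp add: \<beta>_def dual_apply_Dual lin)
  \<comment> \<open>Linearity in the second argument passes to the first by symmetry.\<close>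
  have "B (u + u') w = B u w + B u' w" "B (c *\<^sub>C u) w = c * B u w" for u u' w c
    using lin[of w] by (simp_all add: cfunctional_iff sym[of _ w])
  then have \<beta>: "clinear \<beta>"
    by (auto simp: clinear_iff \<beta>_apply dual_apply_ops intro!: dual_eqI)
  have "u = 0" if "\<beta> u = 0" for u
    using nondeg[of u] \<beta>_apply[of u] that by (simp add: dual_apply_ops)
  then have bij: "bij \<beta>" by (rule inj_to_dual_imp_bij[OF assms(1) \<beta>])
  define \<theta> where "\<theta> = inv \<beta>"
  have \<theta>\<beta>: "\<theta> (\<beta> u) = u" and \<beta>\<theta>: "\<beta> (\<theta> \<xi>) = \<xi>" for u \<xi>
    using bij by (simp_all add: \<theta>_def bij_is_inj bij_is_surj surj_f_inv_f)
  have \<theta>: "clinear \<theta>"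
    unfolding clinear_iff by (metis \<theta>\<beta> \<beta>\<theta> clinear_add[OF \<beta>] clinear_scaleC[OF \<beta>])
  have \<kappa>: "clinear (\<beta> \<circ> f)"
    by (simp add: clinear_iff clinearD[OF \<beta>] clinearD[OF f])
  \<comment> \<open>The two sides are \<open>B (\<theta> \<xi>) (\<theta> \<eta>)\<close> and
    \<open>B (\<theta> \<eta>) (\<theta> \<xi>)\<close>.\<close>
  have "dual_apply (dual_map \<theta> \<xi>) \<eta> = dual_apply ((bidual \<circ> \<theta>) \<xi>) \<eta>" for \<xi> \<eta>
    using \<beta>_apply[of "\<theta> \<xi>" "\<theta> \<eta>"] \<beta>_apply[of "\<theta> \<eta>" "\<theta> \<xi>"] sym[of "\<theta> \<xi>" "\<theta> \<eta>"]
    by (simp add: dual_apply_dual_map[OF \<theta>] dual_apply_bidual \<beta>\<theta>)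
  then have "dual_map \<theta> = bidual \<circ> \<theta>" by (intro ext dual_eqI)
  \<comment> \<open>The left side is \<open>B (f w) u\<close>, the right side
    \<open>B (f u) w\<close>; symmetry and self-adjointness identify both with
    \<open>B u (f w)\<close>.\<close>
  moreover have "dual_apply ((dual_map (\<beta> \<circ> f) \<circ> bidual) u) w = dual_apply ((\<beta> \<circ> f) u) w" for u w
    using sym[of "f w" u] adj[of u w]
    by (simp add: dual_apply_dual_map[OF \<kappa>] dual_apply_bidual \<beta>_apply)
  then have "dual_map (\<beta> \<circ> f) \<circ> bidual = \<beta> \<circ> f" by (intro ext dual_eqI)
  moreover have "bij \<theta>" unfolding \<theta>_def using bij by (rule bij_imp_bij_inv)
  moreover have "f = \<theta> \<circ> (\<beta> \<circ> f)" by (simp add: fun_eq_iff \<theta>\<beta>)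
  ultimately show ?thesis using \<theta> \<kappa> by blast
qed

end
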